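(* Let $(A,\cdot,[-,-],P)$ be a relative Poisson algebra, let $(A,\circ)$ be an anti-pre-Lie algebra whose sub-adjacent Lie algebra is $(A,[-,-])$, and let $Q:A\rightarrow A$ be a linear map. Then the following conditions are equivalent. (1) $(A,\cdot,\circ,P,Q)$ is a relative PCA algebra. (2) $(-\mathcal{L}^{*}_{\cdot},-\mathcal{L}^{*}_{\circ},Q^{*},A^{*})$ is a representation of the relative Poisson algebra $(A,\cdot,[-,-],P)$. (3) $(\mathcal{L}_{\cdot},-\mathcal{L}_{\circ},-Q,A)$ is a representation of the relative Poisson algebra $(A,\cdot,[-,-],P)$. (4) The direct sum $A\oplus A^{*}$, with the operations $$(x+a^{*})\cdot(y+b^{*})=x\cdot y-\mathcal{L}^{*}_{\cdot}(x)b^{*}-\mathcal{L}^{*}_{\cdot}(y)a^{*},\qquad [x+a^{*},y+b^{*}]=[x,y]-\mathcal{L}^{*}_{\circ}(x)b^{*}+\mathcal{L}^{*}_{\circ}(y)a^{*}$$ for all $x,y\in A$, $a^{*},b^{*}\in A^{*}$, and the linear map $P+Q^{*}$, is a relative Poisson algebra.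
   Context: All vector spaces are finite-dimensional over an algebraically closed field $\mathbb K$ of characteristic zero. For a binary operation $\diamond$ on $A$, $\mathcal{L}_{\diamond}(x)y=x\diamond y$. For a linear map $f:A\rightarrow \mathrm{End}_{\mathbb K}(V)$, $f^{*}:A\rightarrow\mathrm{End}_{\mathbb K}(V^{*})$ is defined by $\langle f^{*}(x)u^{*},v\rangle=-\langle u^{*},f(x)v\rangle$. For a linear map $Q:A\to A$, $Q^{*}:A^{*}\to A^{*}$ is the usual transpose (no sign): $\langle Q^*(a^* ),x\rangle=\langle a^*,Q(x)\rangle$. $P+Q^*$ denotes the map $x+a^*\mapsto P(x)+Q^*(a^* )$. A relative Poisson algebra is a quadruple $(A,\cdot,[-,-],P)$ where $(A,\cdot)$ is a commutative associative algebra (not necessarily unital), $(A,[-,-])$ is a Lie algebra, $P$ is a derivation of both $(A,\cdot)$ and $(A,[-,-])$, and $[z,x\cdot y]=[z,x]\cdot y+x\cdot[z,y]+x\cdot y\cdot P(z)$ for all $x,y,z\in A$. A representation of a relative Poisson algebra $(A,\cdot,[-,-],P)$ is a quadruple $(\mu,\rho,\alpha,V)$, where $V$ is a vector space and $\mu,\rho:A\to\mathrm{End}_{\mathbb K}(V)$, $\alpha:V\to V$ are linear maps, such that $\mu(x\cdot y)=\mu(x)\mu(y)$, $\rho([x,y])=\rho(x)\rho(y)-\rho(y)\rho(x)$, and for all $x,y\in A$, $v\in V$: $\alpha(\mu(x)v)-\mu(P(x))v-\mu(x)\alpha(v)=0$; $\alpha(\rho(x)v)-\rho(P(x))v-\rho(x)\alpha(v)=0$;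 $\rho(y)\mu(x)v-\mu(x)\rho(y)v+\mu([x,y])v-\mu(x\cdot P(y))v=0$; $\rho(x\cdot y)v-\mu(x)\rho(y)v-\mu(y)\rho(x)v+\mu(x\cdot y)\alpha(v)=0$. An anti-pre-Lie algebra is a pair $(A,\circ)$ with a binary operation $\circ$ on a vector space $A$ such that, with $[x,y]=x\circ y-y\circ x$, one has $x\circ(y\circ z)-y\circ(x\circ z)=[y,x]\circ z$ and $[x,y]\circ z+[y,z]\circ x+[z,x]\circ y=0$ for all $x,y,z\in A$. Then $(A,[-,-])$ is a Lie algebra, called the sub-adjacent Lie algebra of $(A,\circ)$. A relative PCA algebra is a tuple $(A,\cdot,\circ,P,Q)$ where $(A,\cdot)$ is a commutative associative algebra, $(A,\circ)$ is an anti-pre-Lie algebra with sub-adjacent Lie algebra $(A,[-,-])$, $P,Q:A\to A$ are linear maps, $(A,\cdot,[-,-],P)$ is a relative Poisson algebra, and for all $x,y,z\in A$: $x\cdot Q(y)-P(x)\cdot y-Q(x\cdot y)=0$; $x\circ Q(y)-P(x)\circ y-Q(x\circ y)=0$; $x\cdot(y\circ z)-y\circ(x\cdot z)+[x,y]\cdot z-x\cdot P(y)\cdot z=0$; $(x\cdot y)\circ z-y\circ(x\cdot z)-x\circ(y\cdot z)+Q(x\cdot y\cdot z)=0$. *)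

theory Defs
  imports
    "HOL-Library.Function_Algebras"
    "HOL-Library.Product_Plus"
    "HOL-Computational_Algebra.Polynomial"
begin

text \<open>
  Vector spaces are subspaces \<open>V\<close> of an ambient vector space. The carrier is needed because the
  linear functionals on \<open>'a\<close> are a proper subset of the type \<open>'a \<Rightarrow> 'k\<close>. Operations are total
  functions on the ambient type, and their values outside the carrier are irrelevant.
\<close>

locale fin_dim_space = vector_space scale
  for scale :: "'k::{alg_closed_field, field_char_0} \<Rightarrow> 'v::ab_group_add \<Rightarrow> 'v" +
  fixes V :: "'v set"
  assumes subspace: "subspace V"
    and finitely_spanned: "\<exists>B. finite B \<and> span B = V"

definition linear_on ::
  "('k \<Rightarrow> 'v \<Rightarrow> 'v) \<Rightarrow> 'v set \<Rightarrow> ('k \<Rightarrow> 'w \<Rightarrow> 'w) \<Rightarrow> 'w set \<Rightarrow> ('v::plus \<Rightarrow> 'w::plus) \<Rightarrow> bool"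
  where "linear_on s V t W f \<longleftrightarrow>
    (\<forall>x\<in>V. f x \<in> W) \<and>
    (\<forall>x\<in>V. \<forall>y\<in>V. f (x + y) = f x + f y) \<and>
    (\<forall>c. \<forall>x\<in>V. f (s c x) = t c (f x))"

text \<open>A linear map \<open>V \<rightarrow> End(W)\<close> is the same as a bilinear map \<open>V \<times> W \<rightarrow> W\<close>, written in curried form.\<close>

definition bilinear_on ::
  "('k \<Rightarrow> 'v \<Rightarrow> 'v) \<Rightarrow> 'v set \<Rightarrow> ('k \<Rightarrow> 'w \<Rightarrow> 'w) \<Rightarrow> 'w set \<Rightarrow> ('k \<Rightarrow> 'u \<Rightarrow> 'u) \<Rightarrow> 'u set \<Rightarrow>
    ('v::plus \<Rightarrow> 'w::plus \<Rightarrow> 'u::plus) \<Rightarrow> bool"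
  where "bilinear_on s V t W r U f \<longleftrightarrow>
    (\<forall>x\<in>V. linear_on t W r U (\<lambda>y. f x y)) \<and>
    (\<forall>y\<in>W. linear_on s V r U (\<lambda>x. f x y))"


locale comm_assoc_algebra = fin_dim_space scale A
  for scale :: "'k::{alg_closed_field, field_char_0} \<Rightarrow> 'a::ab_group_add \<Rightarrow> 'a"
    and A :: "'a set" +
  fixes mul :: "'a \<Rightarrow> 'a \<Rightarrow> 'a"
  assumes mul_bilinear: "bilinear_on scale A scale A scale A mul"
    and mul_commute: "\<lbrakk>x \<in> A; y \<in> A\<rbrakk> \<Longrightarrow> mul x y = mul y x"
    and mul_assoc: "\<lbrakk>x \<in> A; y \<in> A; z \<in> A\<rbrakk> \<Longrightarrow> mul (mul x y) z = mul x (mul y z)"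

locale lie_algebra = fin_dim_space scale A
  for scale :: "'k::{alg_closed_field, field_char_0} \<Rightarrow> 'a::ab_group_add \<Rightarrow> 'a"
    and A :: "'a set" +
  fixes brk :: "'a \<Rightarrow> 'a \<Rightarrow> 'a"
  assumes brk_bilinear: "bilinear_on scale A scale A scale A brk"
    and brk_alternating: "x \<in> A \<Longrightarrow> brk x x = 0"
    and jacobi: "\<lbrakk>x \<in> A; y \<in> A; z \<in> A\<rbrakk> \<Longrightarrow>
      brk x (brk y z) + brk y (brk z x) + brk z (brk x y) = 0"

definition derivation_on ::
  "('k \<Rightarrow> 'a \<Rightarrow> 'a) \<Rightarrow> 'a set \<Rightarrow> ('a::plus \<Rightarrow> 'a \<Rightarrow> 'a) \<Rightarrow> ('a \<Rightarrow> 'a) \<Rightarrow> bool"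
  where "derivation_on s A op D \<longleftrightarrow>
    linear_on s A s A D \<and> (\<forall>x\<in>A. \<forall>y\<in>A. D (op x y) = op (D x) y + op x (D y))"

locale relative_poisson_algebra = comm_assoc_algebra scale A mul + lie_algebra scale A brk
  for scale :: "'k::{alg_closed_field, field_char_0} \<Rightarrow> 'a::ab_group_add \<Rightarrow> 'a"
    and A :: "'a set"
    and mul :: "'a \<Rightarrow> 'a \<Rightarrow> 'a"
    and brk :: "'a \<Rightarrow> 'a \<Rightarrow> 'a" +
  fixes P :: "'a \<Rightarrow> 'a"
  assumes derivation_mul: "derivation_on scale A mul P"
    and derivation_brk: "derivation_on scale A brk P"
    and relative_leibniz: "\<lbrakk>x \<in> A; y \<in> A; z \<in> A\<rbrakk> \<Longrightarrow>
      brk z (mul x y) = mul (brk z x) y + mul x (brk z y) + mul (mul x y) (P z)"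

locale relative_poisson_representation =
  relative_poisson_algebra scale A mul brk P + rep: fin_dim_space scaleV V
  for scale :: "'k::{alg_closed_field, field_char_0} \<Rightarrow> 'a::ab_group_add \<Rightarrow> 'a"
    and A :: "'a set"
    and mul :: "'a \<Rightarrow> 'a \<Rightarrow> 'a"
    and brk :: "'a \<Rightarrow> 'a \<Rightarrow> 'a"
    and P :: "'a \<Rightarrow> 'a"
    and scaleV :: "'k \<Rightarrow> 'v::ab_group_add \<Rightarrow> 'v"
    and V :: "'v set" +
  fixes \<mu> \<rho> :: "'a \<Rightarrow> 'v \<Rightarrow> 'v"
    and \<alpha> :: "'v \<Rightarrow> 'v"
  assumes \<mu>_linear: "bilinear_on scale A scaleV V scaleV V \<mu>"
    and \<rho>_linear: "bilinear_on scale A scaleV V scaleV V \<rho>"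
    and \<alpha>_linear: "linear_on scaleV V scaleV V \<alpha>"
    and \<mu>_mul: "\<lbrakk>x \<in> A; y \<in> A; v \<in> V\<rbrakk> \<Longrightarrow> \<mu> (mul x y) v = \<mu> x (\<mu> y v)"
    and \<rho>_brk: "\<lbrakk>x \<in> A; y \<in> A; v \<in> V\<rbrakk> \<Longrightarrow> \<rho> (brk x y) v = \<rho> x (\<rho> y v) - \<rho> y (\<rho> x v)"
    and \<alpha>_\<mu>: "\<lbrakk>x \<in> A; v \<in> V\<rbrakk> \<Longrightarrow> \<alpha> (\<mu> x v) - \<mu> (P x) v - \<mu> x (\<alpha> v) = 0"
    and \<alpha>_\<rho>: "\<lbrakk>x \<in> A; v \<in> V\<rbrakk> \<Longrightarrow> \<alpha> (\<rho> x v) - \<rho> (P x) v - \<rho> x (\<alpha> v) = 0"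
    and \<rho>_\<mu>: "\<lbrakk>x \<in> A; y \<in> A; v \<in> V\<rbrakk> \<Longrightarrow>
      \<rho> y (\<mu> x v) - \<mu> x (\<rho> y v) + \<mu> (brk x y) v - \<mu> (mul x (P y)) v = 0"
    and \<rho>_mul: "\<lbrakk>x \<in> A; y \<in> A; v \<in> V\<rbrakk> \<Longrightarrow>
      \<rho> (mul x y) v - \<mu> x (\<rho> y v) - \<mu> y (\<rho> x v) + \<mu> (mul x y) (\<alpha> v) = 0"


definition sub_adjacent :: "('a \<Rightarrow> 'a \<Rightarrow> 'a::minus) \<Rightarrow> 'a \<Rightarrow> 'a \<Rightarrow> 'a"
  where "sub_adjacent circ x y = circ x y - circ y x"

locale anti_pre_lie_algebra = fin_dim_space scale A
  for scale :: "'k::{alg_closed_field, field_char_0} \<Rightarrow> 'a::ab_group_add \<Rightarrow> 'a"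
    and A :: "'a set" +
  fixes circ :: "'a \<Rightarrow> 'a \<Rightarrow> 'a"
  assumes circ_bilinear: "bilinear_on scale A scale A scale A circ"
    and anti_pre_lie: "\<lbrakk>x \<in> A; y \<in> A; z \<in> A\<rbrakk> \<Longrightarrow>
      circ x (circ y z) - circ y (circ x z) = circ (sub_adjacent circ y x) z"
    and anti_pre_lie_cyclic: "\<lbrakk>x \<in> A; y \<in> A; z \<in> A\<rbrakk> \<Longrightarrow>
      circ (sub_adjacent circ x y) z + circ (sub_adjacent circ y z) x
        + circ (sub_adjacent circ z x) y = 0"

locale relative_pca_algebra =
  comm_assoc_algebra scale A mul + anti_pre_lie_algebra scale A circ +
  relative_poisson_algebra scale A mul "sub_adjacent circ" P
  for scale :: "'k::{alg_closed_field, field_char_0} \<Rightarrow> 'a::ab_group_add \<Rightarrow> 'a"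
    and A :: "'a set"
    and mul :: "'a \<Rightarrow> 'a \<Rightarrow> 'a"
    and circ :: "'a \<Rightarrow> 'a \<Rightarrow> 'a"
    and P :: "'a \<Rightarrow> 'a" +
  fixes Q :: "'a \<Rightarrow> 'a"
  assumes Q_linear: "linear_on scale A scale A Q"
    and mul_Q: "\<lbrakk>x \<in> A; y \<in> A\<rbrakk> \<Longrightarrow> mul x (Q y) - mul (P x) y - Q (mul x y) = 0"
    and circ_Q: "\<lbrakk>x \<in> A; y \<in> A\<rbrakk> \<Longrightarrow> circ x (Q y) - circ (P x) y - Q (circ x y) = 0"
    and mul_circ: "\<lbrakk>x \<in> A; y \<in> A; z \<in> A\<rbrakk> \<Longrightarrow>
      mul x (circ y z) - circ y (mul x z) + mul (sub_adjacent circ x y) z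
        - mul (mul x (P y)) z = 0"
    and circ_mul: "\<lbrakk>x \<in> A; y \<in> A; z \<in> A\<rbrakk> \<Longrightarrow>
      circ (mul x y) z - circ y (mul x z) - circ x (mul y z) + Q (mul (mul x y) z) = 0"


text \<open>The dual of the vector space carried by the whole type \<open>'a\<close>, inside \<open>'a \<Rightarrow> 'k\<close>.\<close>

definition dual_space :: "('k::field \<Rightarrow> 'a::ab_group_add \<Rightarrow> 'a) \<Rightarrow> ('a \<Rightarrow> 'k) set"
  where "dual_space scale = {u. Vector_Spaces.linear scale (*) u}"

definition dual_scale :: "'k::times \<Rightarrow> ('a \<Rightarrow> 'k) \<Rightarrow> 'a \<Rightarrow> 'k"
  where "dual_scale c u = (\<lambda>v. c * u v)"

definition sum_scale :: "('k \<Rightarrow> 'v \<Rightarrow> 'v) \<Rightarrow> ('k \<Rightarrow> 'w \<Rightarrow> 'w) \<Rightarrow> 'k \<Rightarrow> 'v \<times> 'w \<Rightarrow> 'v \<times> 'w"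
  where "sum_scale s t c = (\<lambda>(v, w). (s c v, t c w))"

definition left_mult :: "('a \<Rightarrow> 'a \<Rightarrow> 'a) \<Rightarrow> 'a \<Rightarrow> 'a \<Rightarrow> 'a"
  where "left_mult op x = (\<lambda>y. op x y)"

text \<open>
  The two duals differ by a sign: \<open>f\<^sup>*\<close> for \<open>f : A \<rightarrow> End(V)\<close> carries the sign of the contragredient,
  \<open>Q\<^sup>*\<close> for an endomorphism \<open>Q\<close> does not.
\<close>

definition contragredient :: "('a \<Rightarrow> 'v \<Rightarrow> 'v) \<Rightarrow> 'a \<Rightarrow> ('v \<Rightarrow> 'k::uminus) \<Rightarrow> 'v \<Rightarrow> 'k"
  where "contragredient f x u = (\<lambda>v. - u (f x v))"

definition dual_map :: "('v \<Rightarrow> 'v) \<Rightarrow> ('v \<Rightarrow> 'k) \<Rightarrow> 'v \<Rightarrow> 'k"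
  where "dual_map Q u = (\<lambda>v. u (Q v))"

end

theory Submission
  imports Defs
begin

text \<open>
  Being a representation is the same as turning the semidirect product into a relative Poisson
  algebra, because the conditions on a representation are the components of the algebra axioms
  that are linear in \<open>V\<close>. For the dual representation these conditions, evaluated at \<open>z\<close>, are
  arbitrary functionals applied to the axioms of a relative PCA algebra. The regular representation
  differs in the last condition only. There, rewriting \<open>y \<circ> (x \<cdot> z)\<close> and \<open>x \<circ> (y \<cdot> z)\<close> by the
  axiom for \<open>x \<cdot> (y \<circ> z)\<close> makes the two brackets cancel and leaves \<open>P (x \<cdot> y) \<cdot> z\<close>, which
  \<open>P (x \<cdot> y) \<cdot> z + Q (x \<cdot> y \<cdot> z) = x \<cdot> y \<cdot> Q z\<close> absorbs.
\<close>

section \<open>Linear maps on carriers\<close>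

lemma linear_onD:
  assumes "linear_on s V t W f"
  shows "x \<in> V \<Longrightarrow> f x \<in> W"
    and "x \<in> V \<Longrightarrow> y \<in> V \<Longrightarrow> f (x + y) = f x + f y"
    and "x \<in> V \<Longrightarrow> f (s c x) = t c (f x)"
  using assms unfolding linear_on_def by auto

lemma bilinear_onD:
  assumes "bilinear_on s V t W r U f"
  shows "x \<in> V \<Longrightarrow> y \<in> W \<Longrightarrow> f x y \<in> U"
    and "x \<in> V \<Longrightarrow> y \<in> W \<Longrightarrow> y' \<in> W \<Longrightarrow> f x (y + y') = f x y + f x y'"
    and "x \<in> V \<Longrightarrow> x' \<in> V \<Longrightarrow> y \<in> W \<Longrightarrow> f (x + x') y = f x y + f x' y"
    and "x \<in> V \<Longrightarrow> y \<in> W \<Longrightarrow> f x (t c y) = r c (f x y)"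
    and "x \<in> V \<Longrightarrow> y \<in> W \<Longrightarrow> f (s c x) y = r c (f x y)"
  using assms unfolding bilinear_on_def linear_on_def by auto

lemma bilinear_onI:
  assumes "\<And>x y. x \<in> V \<Longrightarrow> y \<in> W \<Longrightarrow> f x y \<in> U"
    and "\<And>x y y'. x \<in> V \<Longrightarrow> y \<in> W \<Longrightarrow> y' \<in> W \<Longrightarrow> f x (y + y') = f x y + f x y'"
    and "\<And>x x' y. x \<in> V \<Longrightarrow> x' \<in> V \<Longrightarrow> y \<in> W \<Longrightarrow> f (x + x') y = f x y + f x' y"
    and "\<And>x y c. x \<in> V \<Longrightarrow> y \<in> W \<Longrightarrow> f x (t c y) = r c (f x y)"
    and "\<And>x y c. x \<in> V \<Longrightarrow> y \<in> W \<Longrightarrow> f (s c x) y = r c (f x y)"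
  shows "bilinear_on s V t W r U f"
  using assms unfolding bilinear_on_def linear_on_def by auto

lemma linear_on_UNIV_iff:
  assumes "vector_space s" "vector_space t"
  shows "linear_on s UNIV t UNIV f \<longleftrightarrow> Vector_Spaces.linear s t f"
  using assms unfolding linear_on_def Vector_Spaces.linear_iff by auto

lemma linear_on_zero:
  assumes "fin_dim_space s V" "vector_space t" "linear_on s V t W f"
  shows "f 0 = 0"
proof -
  interpret S: fin_dim_space s V by fact
  interpret T: vector_space t by fact
  have "f (s 0 0) = t 0 (f 0)"
    by (rule linear_onD(3)[OF assms(3) S.subspace_0[OF S.subspace]])
  then show ?thesis by simp
qed

text \<open>\<open>linear_on\<close> speaks of sums only, so additivity is applied to
  \<open>x - y\<close> and \<open>y\<close>. This requires \<open>x - y\<close> to lie in the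
  carrier, which is where the subspace property enters.\<close>

lemma linear_on_diff:
  assumes "fin_dim_space s V" "vector_space t" "linear_on s V t W f" "x \<in> V" "y \<in> V"
  shows "f (x - y) = f x - f y"
proof -
  interpret S: fin_dim_space s V by fact
  have "f (x - y + y) = f (x - y) + f y"
    by (rule linear_onD(2)[OF assms(3) S.subspace_diff[OF S.subspace assms(4,5)] assms(5)])
  then show ?thesis by simp
qed

lemma bilinear_on_zero:
  assumes "fin_dim_space s V" "fin_dim_space t W" "vector_space r" "bilinear_on s V t W r U f"
  shows "x \<in> V \<Longrightarrow> f x 0 = 0" and "y \<in> W \<Longrightarrow> f 0 y = 0"
proof -
  show "x \<in> V \<Longrightarrow> f x 0 = 0"
    using linear_on_zero[OF assms(2,3), of U "f x"] assms(4) unfolding bilinear_on_def by blast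
  show "y \<in> W \<Longrightarrow> f 0 y = 0"
    using linear_on_zero[OF assms(1,3), of U "\<lambda>x. f x y"] assms(4) unfolding bilinear_on_def by blast
qed

lemma bilinear_on_diff:
  assumes "fin_dim_space s V" "fin_dim_space t W" "vector_space r" "bilinear_on s V t W r U f"
  shows "x \<in> V \<Longrightarrow> y \<in> W \<Longrightarrow> y' \<in> W \<Longrightarrow> f x (y - y') = f x y - f x y'"
    and "x \<in> V \<Longrightarrow> x' \<in> V \<Longrightarrow> y \<in> W \<Longrightarrow> f (x - x') y = f x y - f x' y"
proof -
  show "x \<in> V \<Longrightarrow> y \<in> W \<Longrightarrow> y' \<in> W \<Longrightarrow> f x (y - y') = f x y - f x y'"
    using linear_on_diff[OF assms(2,3), of U "f x"] assms(4) unfolding bilinear_on_def by blast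
  show "x \<in> V \<Longrightarrow> x' \<in> V \<Longrightarrow> y \<in> W \<Longrightarrow> f (x - x') y = f x y - f x' y"
    using linear_on_diff[OF assms(1,3), of U "\<lambda>x. f x y"] assms(4) unfolding bilinear_on_def by blast
qed

lemma bilinear_on_uminus:
  assumes "fin_dim_space s V" "fin_dim_space t W" "vector_space r" "bilinear_on s V t W r U f"
    and "x \<in> V" "y \<in> W"
  shows "f x (- y) = - f x y"
proof -
  interpret T: fin_dim_space t W by fact
  show ?thesis
    using bilinear_on_diff(1)[OF assms(1-5) T.subspace_0[OF T.subspace] assms(6)]
      bilinear_on_zero(1)[OF assms(1-5)] by simp
qed

section \<open>Direct sums and duals\<close>

lemma sum_fun_apply: "(\<Sum>i\<in>I. f i) x = (\<Sum>i\<in>I. f i x)"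
  by (induction I rule: infinite_finite_induct) (auto simp: zero_fun_def)

lemma vector_space_sum_scale:
  assumes "vector_space s" "vector_space t"
  shows "vector_space (sum_scale s t)"
proof -
  interpret S: vector_space s by fact
  interpret T: vector_space t by fact
  show ?thesis
    by unfold_locales (auto simp: sum_scale_def algebra_simps split: prod.splits)
qed

text \<open>Spanning sets of both factors, embedded by the two inclusions, together span the
  product: the span of a union is the sum of the spans, and linear maps carry spans to
  spans.\<close>

lemma fin_dim_space_sum:
  assumes "fin_dim_space s V" "fin_dim_space t W"
  shows "fin_dim_space (sum_scale s t) (V \<times> W)"
proof -
  interpret S: fin_dim_space s V by fact
  interpret T: fin_dim_space t W by fact
  interpret ST: vector_space "sum_scale s t"
    by (intro vector_space_sum_scale S.vector_space_axioms T.vector_space_axioms)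
  obtain B C where BC: "finite B" "S.span B = V" "finite C" "T.span C = W"
    using S.finitely_spanned T.finitely_spanned by blast
  interpret L: Vector_Spaces.linear s "sum_scale s t" "\<lambda>x. (x, 0)"
    by unfold_locales (auto simp: sum_scale_def)
  interpret R: Vector_Spaces.linear t "sum_scale s t" "\<lambda>y. (0, y)"
    by unfold_locales (auto simp: sum_scale_def)
  have "ST.span ((\<lambda>x. (x, 0)) ` B \<union> (\<lambda>y. (0, y)) ` C) = V \<times> W"
    unfolding ST.span_Un L.span_image R.span_image BC by (auto simp: image_iff)
  moreover have "ST.subspace (V \<times> W)"
    unfolding ST.subspace_def
    by (auto simp: sum_scale_def mem_Times_iff case_prod_unfold
        intro: S.subspace_0 S.subspace_add S.subspace_scale T.subspace_0 T.subspace_add T.subspace_scale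
          S.subspace T.subspace)
  moreover have "finite ((\<lambda>x. (x, 0)) ` B \<union> (\<lambda>y. (0, y)) ` C)"
    using BC by simp
  ultimately show ?thesis
    by (intro fin_dim_space.intro ST.vector_space_axioms fin_dim_space_axioms.intro exI conjI)
qed

lemma vector_space_dual_scale: "vector_space (dual_scale :: 'k::field \<Rightarrow> ('a \<Rightarrow> 'k) \<Rightarrow> 'a \<Rightarrow> 'k)"
  by unfold_locales (auto simp: dual_scale_def fun_eq_iff algebra_simps)

lemma dual_space_iff:
  assumes "vector_space s"
  shows "u \<in> dual_space s \<longleftrightarrow> (\<forall>x y. u (x + y) = u x + u y) \<and> (\<forall>c x. u (s c x) = c * u x)"
proof -
  have "vector_space ((*) :: 'a \<Rightarrow> 'a \<Rightarrow> 'a)"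
    by unfold_locales (simp_all add: algebra_simps)
  then show ?thesis
    using assms by (simp add: dual_space_def Vector_Spaces.linear_iff)
qed

lemma linear_dual_space: "u \<in> dual_space s \<Longrightarrow> Vector_Spaces.linear s (*) u"
  by (simp add: dual_space_def)

lemma dual_space_simps:
  assumes "u \<in> dual_space s"
  shows "u (x + y) = u x + u y" "u (x - y) = u x - u y" "u (- x) = - u x" "u 0 = 0"
    "u (s c x) = c * u x"
proof -
  interpret u: Vector_Spaces.linear s "(*)" u by (rule linear_dual_space[OF assms])
  show "u (x + y) = u x + u y" "u (x - y) = u x - u y" "u (- x) = - u x" "u 0 = 0"
    "u (s c x) = c * u x"
    by (simp_all add: u.add u.diff u.neg u.zero u.scale)
qed

section \<open>Coordinate functionals and the finite-dimensional dual\<close>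

context fin_dim_space
begin

text \<open>A basis is extracted from a finite spanning set. Off the basis
  \<open>representation\<close> is zero, so the coordinate functional lies in the dual for every
  \<open>b\<close>. The assumption \<open>V = UNIV\<close> matches \<open>dual_space\<close>, whose
  functionals live on the whole type.\<close>

lemma coordinates:
  assumes "V = UNIV"
  obtains B where "finite B"
    "\<And>b. (\<lambda>v. representation B v b) \<in> dual_space scale"
    "\<And>v. (\<Sum>b\<in>B. scale (representation B v b) b) = v"
proof -
  obtain C where C: "finite C" "span C = UNIV"
    using finitely_spanned unfolding assms by (elim exE conjE)
  \<comment> \<open>Maximality puts \<open>C\<close> inside \<open>span B\<close>, hence also
    \<open>span C\<close>, which is everything.\<close>
  obtain B where B: "B \<subseteq> C" "independent B" "span B = UNIV"
    using maximal_independent_subset[of C] span_minimal[OF _ subspace_span, of C] unfolding C(2)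
    by (metis top.extremum_uniqueI)
  then have "finite B" using C finite_subset by blast
  show thesis
  proof (rule that[OF \<open>finite B\<close>])
    show "(\<lambda>v. representation B v b) \<in> dual_space scale" for b
      using B by (auto simp: dual_space_iff[OF vector_space_axioms] representation_add representation_scale)
    show "(\<Sum>b\<in>B. scale (representation B v b) b) = v" for v
      using B \<open>finite B\<close> by (intro sum_representation_eq) auto
  qed
qed

text \<open>A vector killed by all functionals has zero coordinates in a basis. This reads
  identities between functionals back as identities in the algebra.\<close>

lemma dual_space_separates:
  assumes "V = UNIV"
  shows "(\<forall>u\<in>dual_space scale. u x = 0) \<longleftrightarrow> x = 0"
proof
  obtain B where B: "\<And>b. (\<lambda>v. representation B v b) \<in> dual_space scale"
    "\<And>v. (\<Sum>b\<in>B. scale (representation B v b) b) = v"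
    by (rule coordinates[OF assms]) blast
  assume "\<forall>u\<in>dual_space scale. u x = 0"
  from bspec[OF this B(1)] have "representation B x b = 0" for b .
  with B(2)[of x] show "x = 0" by simp
qed (simp add: dual_space_simps)

lemma fin_dim_space_dual:
  assumes "V = UNIV"
  shows "fin_dim_space dual_scale (dual_space scale)"
proof -
  interpret D: vector_space "dual_scale :: 'k \<Rightarrow> ('v \<Rightarrow> 'k) \<Rightarrow> 'v \<Rightarrow> 'k"
    by (rule vector_space_dual_scale)
  obtain B where B: "finite B" "\<And>b. (\<lambda>v. representation B v b) \<in> dual_space scale"
    "\<And>v. (\<Sum>b\<in>B. scale (representation B v b) b) = v"
    by (rule coordinates[OF assms]) blast
  let ?C = "(\<lambda>b v. representation B v b) ` B"
  have sub: "D.subspace (dual_space scale)"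
    unfolding D.subspace_def by (auto simp: dual_space_iff[OF vector_space_axioms] dual_scale_def algebra_simps)
  have "u \<in> D.span ?C" if u: "u \<in> dual_space scale" for u
  proof -
    interpret u: Vector_Spaces.linear scale "(*)" u by (rule linear_dual_space[OF u])
    \<comment> \<open>Expansion in the dual basis: the coefficient of \<open>u\<close> at a
      coordinate functional is its value on the corresponding basis vector.\<close>
    have "u = (\<Sum>b\<in>B. dual_scale (u b) (\<lambda>v. representation B v b))"
    proof
      fix v
      have "u v = u (\<Sum>b\<in>B. scale (representation B v b) b)" by (simp add: B(3))
      also have "\<dots> = (\<Sum>b\<in>B. u b * representation B v b)" by (simp add: u.sum u.scale mult.commute)
      also have "\<dots> = (\<Sum>b\<in>B. dual_scale (u b) (\<lambda>v. representation B v b)) v"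
        by (simp add: sum_fun_apply dual_scale_def)
      finally show "u v = (\<Sum>b\<in>B. dual_scale (u b) (\<lambda>v. representation B v b)) v" .
    qed
    also have "\<dots> \<in> D.span ?C"
      by (intro D.span_sum D.span_scale D.span_base imageI)
    finally show ?thesis .
  qed
  moreover have "D.span ?C \<subseteq> dual_space scale"
    using B(2) by (intro D.span_minimal sub) auto
  ultimately have "D.span ?C = dual_space scale" by blast
  with B(1) sub show ?thesis by unfold_locales auto
qed

end

section \<open>Semidirect products\<close>

text \<open>The square-zero extension of the algebra by the module: for bilinear operations, two
  elements of the module multiply to zero.\<close>

definition semidirect_mul ::
  "('a \<Rightarrow> 'a \<Rightarrow> 'a) \<Rightarrow> ('a \<Rightarrow> 'v \<Rightarrow> 'v::plus) \<Rightarrow> 'a \<times> 'v \<Rightarrow> 'a \<times> 'v \<Rightarrow> 'a \<times> 'v"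
  where "semidirect_mul mul \<mu> = (\<lambda>(x, a) (y, b). (mul x y, \<mu> x b + \<mu> y a))"

definition semidirect_brk ::
  "('a \<Rightarrow> 'a \<Rightarrow> 'a) \<Rightarrow> ('a \<Rightarrow> 'v \<Rightarrow> 'v::minus) \<Rightarrow> 'a \<times> 'v \<Rightarrow> 'a \<times> 'v \<Rightarrow> 'a \<times> 'v"
  where "semidirect_brk brk \<rho> = (\<lambda>(x, a) (y, b). (brk x y, \<rho> x b - \<rho> y a))"

text \<open>Polarization: expand the vanishing bracket of \<open>x + y\<close> with itself.\<close>

lemma (in lie_algebra) brk_commute:
  assumes "x \<in> A" "y \<in> A"
  shows "brk x y = - brk y x"
proof -
  note add = bilinear_onD(2,3)[OF brk_bilinear] subspace_add[OF subspace]
  have "brk (x + y) (x + y) = 0" using assms by (intro brk_alternating add)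
  moreover have "brk (x + y) (x + y) = brk x x + brk x y + (brk y x + brk y y)"
    using assms by (simp add: add add_ac)
  ultimately show ?thesis using assms by (simp add: brk_alternating eq_neg_iff_add_eq_0)
qed

text \<open>Reconciles the order of the bracket in the representation conditions with the order that
  the relative Leibniz rule produces. The minus sign is pulled out of the first argument as a
  difference from 0.\<close>

lemma (in lie_algebra) bilinear_brk_commute:
  assumes "fin_dim_space t W" "vector_space r" "bilinear_on scale A t W r U f"
    and "x \<in> A" "y \<in> A" "v \<in> W"
  shows "f (brk x y) v = - f (brk y x) v"
proof -
  have "f (brk x y) v = f (0 - brk y x) v"
    using brk_commute[of x y] assms(4,5) by simp
  also have "\<dots> = f 0 v - f (brk y x) v"
    using assms subspace_0[OF subspace] bilinear_onD(1)[OF brk_bilinear]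
    by (intro bilinear_on_diff[OF fin_dim_space_axioms assms(1-3)]) auto
  finally show ?thesis
    using bilinear_on_zero(2)[OF fin_dim_space_axioms assms(1-3)] assms(6) by simp
qed

text \<open>The \<open>A\<close>-component of each axiom is the axiom of \<open>A\<close>. In the
  \<open>V\<close>-component every term contains exactly one entry from \<open>V\<close>, and
  collecting terms by that entry leaves the representation conditions.\<close>

lemma (in relative_poisson_representation) relative_poisson_algebra_semidirect:
  "relative_poisson_algebra (sum_scale scale scaleV) (A \<times> V)
    (semidirect_mul mul \<mu>) (semidirect_brk brk \<rho>) (map_prod P \<alpha>)"
proof -
  note fd = fin_dim_space_axioms rep.fin_dim_space_axioms
  interpret S: fin_dim_space "sum_scale scale scaleV" "A \<times> V" by (intro fin_dim_space_sum fd)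
  have P_linear: "linear_on scale A scale A P" using derivation_mul by (simp add: derivation_on_def)
  have P_mul: "P (mul x y) = mul (P x) y + mul x (P y)"
    and P_brk: "P (brk x y) = brk (P x) y + brk x (P y)" if "x \<in> A" "y \<in> A" for x y
    using that derivation_mul derivation_brk by (simp_all add: derivation_on_def)
  note closed = bilinear_onD(1)[OF mul_bilinear] bilinear_onD(1)[OF brk_bilinear]
    bilinear_onD(1)[OF \<mu>_linear] bilinear_onD(1)[OF \<rho>_linear]
    linear_onD(1)[OF P_linear] linear_onD(1)[OF \<alpha>_linear]
    rep.subspace_add[OF rep.subspace] rep.subspace_diff[OF rep.subspace] subspace_add[OF subspace]
  note expand = bilinear_onD(2-5)[OF mul_bilinear] bilinear_onD(2-5)[OF brk_bilinear]
    bilinear_onD(2-5)[OF \<mu>_linear] bilinear_onD(2-5)[OF \<rho>_linear]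
    linear_onD(2,3)[OF P_linear] linear_onD(2,3)[OF \<alpha>_linear]
    linear_on_diff[OF rep.fin_dim_space_axioms rep.vector_space_axioms \<alpha>_linear]
    bilinear_on_diff[OF fd rep.vector_space_axioms \<mu>_linear]
    bilinear_on_diff[OF fd rep.vector_space_axioms \<rho>_linear]
  have \<alpha>\<mu>: "\<alpha> (\<mu> x v) = \<mu> (P x) v + \<mu> x (\<alpha> v)"
    and \<alpha>\<rho>: "\<alpha> (\<rho> x v) = \<rho> (P x) v + \<rho> x (\<alpha> v)" if "x \<in> A" "v \<in> V" for x v
    using \<alpha>_\<mu>[OF that] \<alpha>_\<rho>[OF that] by (simp_all add: algebra_simps)
  \<comment> \<open>The two mixed conditions are oriented as rewrite rules: the first moves
    \<open>\<mu>\<close> to the left of \<open>\<rho>\<close>, the second breaks up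
    \<open>\<rho>\<close> of a product.\<close>
  have \<rho>\<mu>: "\<rho> y (\<mu> x v) = \<mu> x (\<rho> y v) - \<mu> (brk x y) v + \<mu> (mul x (P y)) v"
    and \<rho>mul: "\<rho> (mul x y) v = \<mu> x (\<rho> y v) + \<mu> y (\<rho> x v) - \<mu> (mul x y) (\<alpha> v)"
    if "x \<in> A" "y \<in> A" "v \<in> V" for x y v
    using \<rho>_\<mu>[OF that] \<rho>_mul[OF that] by (simp_all add: algebra_simps)
  note \<mu>_brk_swap = bilinear_brk_commute[OF rep.fin_dim_space_axioms rep.vector_space_axioms \<mu>_linear]
  note defs = semidirect_mul_def semidirect_brk_def sum_scale_def zero_prod_def
  show ?thesis
  proof unfold_locales
    show "bilinear_on (sum_scale scale scaleV) (A \<times> V) (sum_scale scale scaleV) (A \<times> V)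
      (sum_scale scale scaleV) (A \<times> V) (semidirect_mul mul \<mu>)"
      by (intro bilinear_onI; auto simp: defs closed expand rep.scale_right_distrib)
    show "bilinear_on (sum_scale scale scaleV) (A \<times> V) (sum_scale scale scaleV) (A \<times> V)
      (sum_scale scale scaleV) (A \<times> V) (semidirect_brk brk \<rho>)"
      by (intro bilinear_onI; auto simp: defs closed expand rep.scale_right_diff_distrib)
    show "derivation_on (sum_scale scale scaleV) (A \<times> V) (semidirect_mul mul \<mu>) (map_prod P \<alpha>)"
      by (auto simp: derivation_on_def linear_on_def defs closed expand P_mul \<alpha>\<mu>)
    show "derivation_on (sum_scale scale scaleV) (A \<times> V) (semidirect_brk brk \<rho>) (map_prod P \<alpha>)"
      by (auto simp: derivation_on_def linear_on_def defs closed expand P_brk \<alpha>\<rho>)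
  next
    fix p q assume "p \<in> A \<times> V" "q \<in> A \<times> V"
    then show "semidirect_mul mul \<mu> p q = semidirect_mul mul \<mu> q p"
      by (auto simp: defs mul_commute add.commute)
  next
    fix p assume "p \<in> A \<times> V"
    then show "semidirect_brk brk \<rho> p p = 0"
      by (auto simp: defs brk_alternating)
  next
    fix p q r assume pqr: "p \<in> A \<times> V" "q \<in> A \<times> V" "r \<in> A \<times> V"
    show "semidirect_mul mul \<mu> (semidirect_mul mul \<mu> p q) r
        = semidirect_mul mul \<mu> p (semidirect_mul mul \<mu> q r)"
    proof -
      \<comment> \<open>The multiplication operators commute because \<open>mul\<close> does.
        Associativity needs this when the entry from \<open>V\<close> sits in the first or the
        middle factor.\<close>
      have "\<mu> x (\<mu> y v) = \<mu> y (\<mu> x v)" if "x \<in> A" "y \<in> A" "v \<in> V" for x y v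
        using that \<mu>_mul mul_commute by metis
      then show ?thesis
        using pqr by (auto simp: defs closed expand mul_assoc \<mu>_mul add_ac)
    qed
    show "semidirect_brk brk \<rho> p (semidirect_brk brk \<rho> q r)
        + semidirect_brk brk \<rho> q (semidirect_brk brk \<rho> r p)
        + semidirect_brk brk \<rho> r (semidirect_brk brk \<rho> p q) = 0"
      using pqr by (auto simp: defs closed expand jacobi \<rho>_brk)
    show "semidirect_brk brk \<rho> r (semidirect_mul mul \<mu> p q)
        = semidirect_mul mul \<mu> (semidirect_brk brk \<rho> r p) q
          + semidirect_mul mul \<mu> p (semidirect_brk brk \<rho> r q)
          + semidirect_mul mul \<mu> (semidirect_mul mul \<mu> p q) (map_prod P \<alpha> r)"
    proof -
      obtain x a y b z c where *: "p = (x, a)" "q = (y, b)" "r = (z, c)"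
        and in_carrier: "x \<in> A" "y \<in> A" "z \<in> A" "a \<in> V" "b \<in> V" "c \<in> V"
        using pqr by (cases p, cases q, cases r) auto
      \<comment> \<open>The Leibniz rule multiplies by \<open>P z\<close> last, whereas the mixed
        condition contains \<open>\<mu>\<close> of the product with \<open>P z\<close>.\<close>
      have "\<mu> (mul x (P z)) b = \<mu> (P z) (\<mu> x b)" "\<mu> (mul y (P z)) a = \<mu> (P z) (\<mu> y a)"
        using in_carrier by (simp_all add: \<mu>_mul[symmetric] closed mul_commute)
      with in_carrier show ?thesis
        by (simp add: * defs closed expand relative_leibniz \<rho>\<mu> \<rho>mul \<mu>_brk_swap[of x z] \<mu>_brk_swap[of y z])
    qed
  qed
qed

text \<open>Testing an axiom on triples or pairs with a single entry \<open>(0, v)\<close> and all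
  others \<open>(x, 0)\<close> isolates one condition. Associativity gives the condition on
  \<open>\<mu>\<close>, Jacobi the one on \<open>\<rho>\<close>, and the derivation rules those on
  \<open>\<alpha>\<close>. The Leibniz rule gives the two mixed conditions, depending on whether
  \<open>v\<close> sits in a factor of the product or in the bracketing slot.\<close>

lemma relative_poisson_representation_semidirect:
  assumes A: "relative_poisson_algebra scale A mul brk P" and V: "fin_dim_space scaleV V"
    and \<mu>: "bilinear_on scale A scaleV V scaleV V \<mu>" and \<rho>: "bilinear_on scale A scaleV V scaleV V \<rho>"
    and \<alpha>: "linear_on scaleV V scaleV V \<alpha>"
    and S: "relative_poisson_algebra (sum_scale scale scaleV) (A \<times> V)
      (semidirect_mul mul \<mu>) (semidirect_brk brk \<rho>) (map_prod P \<alpha>)"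
  shows "relative_poisson_representation scale A mul brk P scaleV V \<mu> \<rho> \<alpha>"
proof -
  interpret relative_poisson_algebra scale A mul brk P by fact
  interpret rep: fin_dim_space scaleV V by fact
  interpret S: relative_poisson_algebra "sum_scale scale scaleV" "A \<times> V"
    "semidirect_mul mul \<mu>" "semidirect_brk brk \<rho>" "map_prod P \<alpha>" by fact
  note fd = fin_dim_space_axioms rep.fin_dim_space_axioms
  have P_linear: "linear_on scale A scale A P" using derivation_mul by (simp add: derivation_on_def)
  note closed = bilinear_onD(1)[OF mul_bilinear] bilinear_onD(1)[OF brk_bilinear]
    bilinear_onD(1)[OF \<mu>] bilinear_onD(1)[OF \<rho>]
    linear_onD(1)[OF P_linear] linear_onD(1)[OF \<alpha>] rep.subspace_0[OF rep.subspace] subspace_0[OF subspace]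
  note zero = linear_on_zero[OF rep.fin_dim_space_axioms rep.vector_space_axioms \<alpha>]
    linear_on_zero[OF fin_dim_space_axioms vector_space_axioms P_linear]
    bilinear_on_zero[OF fd rep.vector_space_axioms \<mu>]
    bilinear_on_zero[OF fd rep.vector_space_axioms \<rho>]
    bilinear_on_zero[OF fin_dim_space_axioms fin_dim_space_axioms vector_space_axioms mul_bilinear]
    bilinear_on_zero[OF fin_dim_space_axioms fin_dim_space_axioms vector_space_axioms brk_bilinear]
  note uminus = bilinear_on_uminus[OF fd rep.vector_space_axioms \<mu>]
    bilinear_on_uminus[OF fd rep.vector_space_axioms \<rho>]
  note defs = semidirect_mul_def semidirect_brk_def zero_prod_def
  have der_mul: "map_prod P \<alpha> (semidirect_mul mul \<mu> p q)
      = semidirect_mul mul \<mu> (map_prod P \<alpha> p) q + semidirect_mul mul \<mu> p (map_prod P \<alpha> q)"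
    and der_brk: "map_prod P \<alpha> (semidirect_brk brk \<rho> p q)
      = semidirect_brk brk \<rho> (map_prod P \<alpha> p) q + semidirect_brk brk \<rho> p (map_prod P \<alpha> q)"
    if "p \<in> A \<times> V" "q \<in> A \<times> V" for p q
    using S.derivation_mul S.derivation_brk that unfolding derivation_on_def by blast+
  have \<mu>_mul: "\<mu> (mul x y) v = \<mu> x (\<mu> y v)" if "x \<in> A" "y \<in> A" "v \<in> V" for x y v
    using S.mul_assoc[of "(x, 0)" "(y, 0)" "(0, v)"] that by (simp add: defs zero closed)
  show ?thesis
  proof unfold_locales
    fix x v assume xv: "x \<in> A" "v \<in> V"
    show "\<alpha> (\<mu> x v) - \<mu> (P x) v - \<mu> x (\<alpha> v) = 0"
      using der_mul[of "(x, 0)" "(0, v)"] xv by (simp add: defs zero closed)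
    show "\<alpha> (\<rho> x v) - \<rho> (P x) v - \<rho> x (\<alpha> v) = 0"
      using der_brk[of "(x, 0)" "(0, v)"] xv by (simp add: defs zero closed)
  next
    fix x y v assume xyv: "x \<in> A" "y \<in> A" "v \<in> V"
    show "\<mu> (mul x y) v = \<mu> x (\<mu> y v)" by (rule \<mu>_mul[OF xyv])
    show "\<rho> (brk x y) v = \<rho> x (\<rho> y v) - \<rho> y (\<rho> x v)"
      using S.jacobi[of "(x, 0)" "(y, 0)" "(0, v)"] xyv
      by (simp add: defs zero closed uminus algebra_simps)
    show "\<rho> y (\<mu> x v) - \<mu> x (\<rho> y v) + \<mu> (brk x y) v - \<mu> (mul x (P y)) v = 0"
      using S.relative_leibniz[of "(x, 0)" "(0, v)" "(y, 0)"] xyv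
        bilinear_brk_commute[OF rep.fin_dim_space_axioms rep.vector_space_axioms \<mu>, of x y v]
        \<mu>_mul[of "P y" x v] mul_commute[of x "P y"]
      by (simp add: defs zero closed algebra_simps)
    show "\<rho> (mul x y) v - \<mu> x (\<rho> y v) - \<mu> y (\<rho> x v) + \<mu> (mul x y) (\<alpha> v) = 0"
      using S.relative_leibniz[of "(x, 0)" "(y, 0)" "(0, v)"] xyv
      by (simp add: defs zero closed uminus algebra_simps)
  qed (fact \<mu> \<rho> \<alpha>)+
qed

section \<open>Relative PCA algebras\<close>

lemma left_mult_eq: "left_mult op = op"
  by (simp add: left_mult_def fun_eq_iff)

text \<open>The two signs cancel, so the dual actions in the theorem are plain precomposition.
  Composing two of them reverses the order of the operators.\<close>

lemma uminus_contragredient: "(- contragredient f) x u = (\<lambda>v. u (f x v))"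
  for u :: "'v \<Rightarrow> 'k::group_add"
  by (simp add: contragredient_def fun_eq_iff)

lemma bilinear_on_uminus_contragredient:
  assumes "vector_space s" "bilinear_on s UNIV s UNIV s UNIV f"
  shows "bilinear_on s UNIV dual_scale (dual_space s) dual_scale (dual_space s) (- contragredient f)"
  unfolding bilinear_on_def linear_on_def uminus_contragredient
  by (auto simp: dual_scale_def fun_eq_iff dual_space_simps dual_space_iff[OF assms(1)]
      bilinear_onD(2-5)[OF assms(2)])

lemma linear_on_dual_map:
  assumes "Vector_Spaces.linear s s Q"
  shows "linear_on dual_scale (dual_space s) dual_scale (dual_space s) (dual_map Q)"
  using assms unfolding linear_on_def dual_map_def Vector_Spaces.linear_iff
  by (auto simp: dual_scale_def fun_eq_iff dual_space_simps dual_space_iff)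

text \<open>Identifies the operations on the direct sum with those of the semidirect product;
  subtracting the negated contragredient gives the plus sign in the bracket.\<close>

lemma semidirect_contragredient:
  "semidirect_mul mul (- contragredient f)
    = (\<lambda>(x, a) (y, b :: 'v \<Rightarrow> 'k::ab_group_add). (mul x y, - contragredient f x b - contragredient f y a))"
  "semidirect_brk brk (- contragredient f)
    = (\<lambda>(x, a) (y, b :: 'v \<Rightarrow> 'k). (brk x y, - contragredient f x b + contragredient f y a))"
  by (simp_all add: semidirect_mul_def semidirect_brk_def fun_eq_iff algebra_simps)

theorem proposition2p10:
  fixes scale :: "'k::{alg_closed_field, field_char_0} \<Rightarrow> 'a::ab_group_add \<Rightarrow> 'a"
    and mul brk circ :: "'a \<Rightarrow> 'a \<Rightarrow> 'a"
    and P Q :: "'a \<Rightarrow> 'a"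
  assumes "relative_poisson_algebra scale UNIV mul brk P"
    and "anti_pre_lie_algebra scale UNIV circ"
    and "brk = sub_adjacent circ"
    and "Vector_Spaces.linear scale scale Q"
  defines "Lm \<equiv> left_mult mul" and "Lc \<equiv> left_mult circ"
  defines "pca \<equiv> relative_pca_algebra scale UNIV mul circ P Q"
    and "dual_rep \<equiv>
      relative_poisson_representation scale UNIV mul brk P dual_scale (dual_space scale)
        (- contragredient Lm) (- contragredient Lc) (dual_map Q)"
    and "regular_rep \<equiv>
      relative_poisson_representation scale UNIV mul brk P scale UNIV Lm (- Lc) (- Q)"
    and "direct_sum \<equiv>
      relative_poisson_algebra (sum_scale scale dual_scale) (UNIV \<times> dual_space scale)
        (\<lambda>(x, a) (y, b). (mul x y, - contragredient Lm x b - contragredient Lm y a))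
        (\<lambda>(x, a) (y, b). (brk x y, - contragredient Lc x b + contragredient Lc y a))
        (\<lambda>(x, a). (P x, dual_map Q a))"
  shows "(pca \<longleftrightarrow> dual_rep) \<and> (pca \<longleftrightarrow> regular_rep) \<and> (pca \<longleftrightarrow> direct_sum)"
proof -
  interpret relative_poisson_algebra scale UNIV mul brk P by fact
  interpret anti_pre_lie_algebra scale UNIV circ by fact
  interpret Q: Vector_Spaces.linear scale scale Q by fact
  interpret dual: fin_dim_space dual_scale "dual_space scale" by (rule fin_dim_space_dual) simp
  note brk_def = assms(3)
  have Lm: "Lm = mul" and Lc: "Lc = circ" by (simp_all add: Lm_def Lc_def left_mult_eq)
  note fd = fin_dim_space_axioms
  note mul_add = bilinear_onD(2,3)[OF mul_bilinear, OF UNIV_I UNIV_I UNIV_I]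
  note uminus = bilinear_on_uminus[OF fd fd vector_space_axioms mul_bilinear, OF UNIV_I UNIV_I]
    bilinear_on_uminus[OF fd fd vector_space_axioms circ_bilinear, OF UNIV_I UNIV_I] Q.neg
  \<comment> \<open>The order is opposite to that of a Lie algebra action. Either negating the left
    multiplications or precomposing with them corrects it, so both \<open>- Lc\<close> and
    \<open>- contragredient Lc\<close> respect the bracket.\<close>
  have circ_brk: "circ (brk x y) z = circ y (circ x z) - circ x (circ y z)" for x y z
    using anti_pre_lie by (simp add: brk_def)
  have mul_brk_commute: "mul (brk y x) z = - mul (brk x y) z" for x y z
    by (rule bilinear_brk_commute[OF fd vector_space_axioms mul_bilinear]) auto
  have P_mul: "P (mul x y) = mul (P x) y + mul x (P y)" for x y
    using derivation_mul by (simp add: derivation_on_def)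
  note separates = dual_space_separates[OF refl]

  \<comment> \<open>The four compatibility axioms are recorded as defects, that is, as elements to
    which functionals can be applied. The first three equivalences or reductions below compare a
    condition with the vanishing of all defects, \<open>compat\<close>.\<close>
  define mul_Q where "mul_Q x y = mul x (Q y) - mul (P x) y - Q (mul x y)" for x y
  define circ_Q where "circ_Q x y = circ x (Q y) - circ (P x) y - Q (circ x y)" for x y
  define mul_circ where "mul_circ x y z = mul x (circ y z) - circ y (mul x z) + mul (brk x y) z
    - mul (mul x (P y)) z" for x y z
  define circ_mul where "circ_mul x y z = circ (mul x y) z - circ y (mul x z) - circ x (mul y z)
    + Q (mul (mul x y) z)" for x y z
  define compat where "compat \<longleftrightarrow> (\<forall>x y. mul_Q x y = 0) \<and> (\<forall>x y. circ_Q x y = 0)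
    \<and> (\<forall>x y z. mul_circ x y z = 0) \<and> (\<forall>x y z. circ_mul x y z = 0)"
  note defs = mul_Q_def circ_Q_def mul_circ_def circ_mul_def

  have "pca \<longleftrightarrow> compat"
  proof
    assume pca
    then interpret pca: relative_pca_algebra scale UNIV mul circ P Q by (simp add: pca_def)
    show compat
      using pca.mul_Q pca.circ_Q pca.mul_circ pca.circ_mul by (simp add: compat_def defs brk_def)
  next
    assume compat
    then show pca
      using relative_poisson_algebra_axioms linear_on_UNIV_iff[OF vector_space_axioms vector_space_axioms] assms(4)
      unfolding pca_def compat_def defs brk_def
      by (intro relative_pca_algebra.intro relative_pca_algebra_axioms.intro
          comm_assoc_algebra_axioms anti_pre_lie_algebra_axioms) auto
  qed
  moreover have "dual_rep \<longleftrightarrow> compat"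
  proof
    assume dual_rep
    then interpret rep: relative_poisson_representation scale UNIV mul brk P dual_scale "dual_space scale"
      "- contragredient mul" "- contragredient circ" "dual_map Q"
      by (simp add: dual_rep_def Lm Lc)
    note apply_defs = uminus_contragredient dual_map_def fun_eq_iff dual_space_simps defs
    have "mul_Q x y = 0" "circ_Q x y = 0" "mul_circ x y z = 0" "circ_mul x y z = 0" for x y z
      unfolding separates[symmetric]
      using rep.\<alpha>_\<mu>[of x] rep.\<alpha>_\<rho>[of x] rep.\<rho>_\<mu>[of x y] rep.\<rho>_mul[of x y]
      \<comment> \<open>Pushing the minus sign inward by \<open>uminus_apply\<close> would destroy
        the pattern of \<open>uminus_contragredient\<close>.\<close>
      by (auto simp: apply_defs simp del: uminus_apply)
    then show compat by (simp add: compat_def)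
  next
    assume compat
    then have zero: "u (mul_Q x y) = 0" "u (circ_Q x y) = 0" "u (mul_circ x y z) = 0" "u (circ_mul x y z) = 0"
      if "u \<in> dual_space scale" for u x y z
      using that by (simp_all add: compat_def dual_space_simps)
    \<comment> \<open>Precomposition reverses the factors, so multiplicativity of the dual action is
      associativity combined with commutativity in this form.\<close>
    have mul_mul: "mul (mul x y) z = mul y (mul x z)" for x y z
      by (metis UNIV_I mul_assoc mul_commute)
    show dual_rep
      unfolding dual_rep_def Lm Lc
    proof unfold_locales
      show "linear_on dual_scale (dual_space scale) dual_scale (dual_space scale) (dual_map Q)"
        by (rule linear_on_dual_map) fact
    qed (use zero in \<open>simp_all add: bilinear_on_uminus_contragredient[OF vector_space_axioms]
        mul_bilinear circ_bilinear uminus_contragredient dual_map_def fun_eq_iff dual_space_simps defs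
        mul_mul circ_brk del: uminus_apply\<close>)
  qed
  moreover have "regular_rep \<longleftrightarrow> compat"
  proof -
    \<comment> \<open>The right-hand side is the negative of the last representation condition for
      \<open>mul\<close>, \<open>- circ\<close>, \<open>- Q\<close>. The other three conditions are
      the remaining defects up to sign, so the premises are available in both directions.\<close>
    have circ_mul_eq: "circ_mul x y z
        = circ (mul x y) z - mul x (circ y z) - mul y (circ x z) + mul (mul x y) (Q z)"
      if "\<And>x y. mul_Q x y = 0" "\<And>x y z. mul_circ x y z = 0" for x y z
    proof -
      have "mul (P (mul x y)) z = mul (mul x (P y)) z + mul (mul y (P x)) z"
        using mul_commute[of "P x" y] by (simp add: P_mul mul_add)
      then show ?thesis
        using that(1)[of "mul x y" z] that(2)[of x y z] that(2)[of y x z] mul_brk_commute[of x y z]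
          mul_commute[of x y]
        unfolding defs by (simp add: algebra_simps)
    qed
    show ?thesis
    proof
      assume regular_rep
      then interpret rep: relative_poisson_representation scale UNIV mul brk P scale UNIV
        mul "- circ" "- Q"
        by (simp add: regular_rep_def Lm Lc)
      have 1: "mul_Q x y = 0" "circ_Q x y = 0" "mul_circ x y z = 0" for x y z
        using rep.\<alpha>_\<mu>[of x y] rep.\<alpha>_\<rho>[of x y] rep.\<rho>_\<mu>[of x y z]
        by (simp_all add: defs uminus algebra_simps)
      moreover have "circ_mul x y z = 0" for x y z
        using rep.\<rho>_mul[of x y z] by (simp add: circ_mul_eq[OF 1(1,3)] uminus algebra_simps)
      ultimately show compat by (simp add: compat_def)
    next
      assume compat
      then have zero: "mul_Q x y = 0" "circ_Q x y = 0" "mul_circ x y z = 0" "circ_mul x y z = 0" for x y z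
        by (simp_all add: compat_def)
      note zero' = zero(1-3)[unfolded defs] zero(4)[unfolded circ_mul_eq[OF zero(1,3)]]
      show regular_rep
        unfolding regular_rep_def Lm Lc
      proof unfold_locales
        show "bilinear_on scale UNIV scale UNIV scale UNIV (- circ)"
          by (intro bilinear_onI) (simp_all add: bilinear_onD(2-5)[OF circ_bilinear])
        show "linear_on scale UNIV scale UNIV (- Q)"
          by (simp add: linear_on_def Q.add Q.scale)
      qed (use zero' in \<open>simp_all add: mul_bilinear mul_assoc circ_brk uminus algebra_simps\<close>)
    qed
  qed
  moreover have "dual_rep \<longleftrightarrow> direct_sum"
  proof -
    have "(\<lambda>(x, a). (P x, dual_map Q a)) = map_prod P (dual_map Q)"
      by (simp add: map_prod_def)
    then show ?thesis
      \<comment> \<open>With the signs rewritten, \<open>direct_sum\<close> is literally the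
        semidirect product, and the two semidirect product lemmas give the two directions.\<close>
      unfolding dual_rep_def direct_sum_def semidirect_contragredient[symmetric] Lm Lc
      using relative_poisson_representation.relative_poisson_algebra_semidirect
        relative_poisson_representation_semidirect[OF assms(1) dual.fin_dim_space_axioms
          bilinear_on_uminus_contragredient[OF vector_space_axioms mul_bilinear]
          bilinear_on_uminus_contragredient[OF vector_space_axioms circ_bilinear]
          linear_on_dual_map[OF assms(4)]]
      by metis
  qed
  ultimately show ?thesis by blast
qed

end
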